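(* For every $n\ge 1$ and every permutation $\pi\in S_n$, there is a simple tangle performing $\pi$ that has at most $\lceil\log_2 n\rceil$ moves in each path.
   Context: $S_n$ is the symmetric group on $\{1,\ldots,n\}$; a permutation is written $\pi=[\pi(1),\ldots,\pi(n)]$, and $\mathrm{id}=[1,\ldots,n]$. Two permutations $\pi,\rho\in S_n$ are adjacent if $|\pi^{-1}(i)-\rho^{-1}(i)|\le 1$ for every $i\in\{1,\ldots,n\}$; equivalently, $\rho$ is obtained from $\pi$ by interchanging the entries in disjoint pairs of neighbouring positions. A tangle is a finite sequence $\pi_1,\ldots,\pi_N$ of permutations in $S_n$ in which each consecutive pair is adjacent. A tangle performs $\pi$ if its first permutation is $\mathrm{id}$ and its last is $\pi$. For an element $i$, path $i$ is the sequence of positions $\pi_1^{-1}(i),\ldots,\pi_N^{-1}(i)$. A move of path $i$ is a maximal subsequence of at least two consecutive permutations of the tangle during which the positions of $i$ form an arithmetic progression of common difference $+1$, or of common difference $-1$. Paths $i$ and $j$ cross between $\pi_t$ and $\pi_{t+1}$ if $i$ and $j$ exchange positions there. A tangle is simple if each pair of paths crosses at most once. *)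

theory Defs
  imports Complex_Main "HOL-Combinatorics.Permutations"
begin

text \<open>
  Elements of the symmetric group on \<open>{1..n}\<close> are functions on \<open>nat\<close> satisfying
  \<open>p permutes {1..n}\<close>; \<open>p k\<close> is the entry in position \<open>k\<close>, so that \<open>inv p i\<close> is the
  position of the element \<open>i\<close>.  A sequence of permutations is a list, indexed from 0.
\<close>

definition adjacent :: "nat \<Rightarrow> (nat \<Rightarrow> nat) \<Rightarrow> (nat \<Rightarrow> nat) \<Rightarrow> bool" where
  "adjacent n p q \<longleftrightarrow> (\<forall>i\<in>{1..n}. \<bar>int (inv p i) - int (inv q i)\<bar> \<le> 1)"

definition tangle :: "nat \<Rightarrow> (nat \<Rightarrow> nat) list \<Rightarrow> bool" where
  "tangle n T \<longleftrightarrow> T \<noteq> [] \<and> (\<forall>p\<in>set T. p permutes {1..n}) \<and>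
     (\<forall>t. Suc t < length T \<longrightarrow> adjacent n (T ! t) (T ! Suc t))"

definition performs :: "(nat \<Rightarrow> nat) list \<Rightarrow> (nat \<Rightarrow> nat) \<Rightarrow> bool" where
  "performs T p \<longleftrightarrow> T \<noteq> [] \<and> hd T = id \<and> last T = p"

definition path :: "(nat \<Rightarrow> nat) list \<Rightarrow> nat \<Rightarrow> int list" where
  "path T i = map (\<lambda>p. int (inv p i)) T"

text \<open>
  A block of consecutive indices \<open>a, \<dots>, b\<close> is represented by the pair \<open>(a, b)\<close>;
  \<open>a < b\<close> says that it contains at least two of them.
\<close>

definition unit_progression :: "int list \<Rightarrow> nat \<Rightarrow> nat \<Rightarrow> bool" where
  "unit_progression xs a b \<longleftrightarrow> a < b \<and> b < length xs \<and>
     (\<exists>d\<in>{1, -1}. \<forall>t\<in>{a..<b}. xs ! Suc t - xs ! t = d)"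

definition moves :: "int list \<Rightarrow> (nat \<times> nat) set" where
  "moves xs = {(a, b). unit_progression xs a b \<and>
     (\<forall>a' b'. unit_progression xs a' b' \<and> a' \<le> a \<and> b \<le> b' \<longrightarrow> a' = a \<and> b' = b)}"

lemma finite_moves: "finite (moves xs)"
proof (rule finite_subset)
  show "moves xs \<subseteq> {..<length xs} \<times> {..<length xs}"
    by (auto simp: moves_def unit_progression_def)
qed simp

text \<open>Paths \<open>i\<close> and \<open>j\<close> cross between the entries \<open>t\<close> and \<open>t + 1\<close> of \<open>T\<close>.\<close>

definition cross :: "(nat \<Rightarrow> nat) list \<Rightarrow> nat \<Rightarrow> nat \<Rightarrow> nat \<Rightarrow> bool" where
  "cross T i j t \<longleftrightarrow> Suc t < length T \<and> i \<noteq> j \<and>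
     inv (T ! Suc t) i = inv (T ! t) j \<and> inv (T ! Suc t) j = inv (T ! t) i"

lemma finite_crossings: "finite {t. cross T i j t}"
  by (rule finite_subset[of _ "{..<length T}"]) (auto simp: cross_def)

definition simple :: "nat \<Rightarrow> (nat \<Rightarrow> nat) list \<Rightarrow> bool" where
  "simple n T \<longleftrightarrow> (\<forall>i\<in>{1..n}. \<forall>j\<in>{1..n}. i \<noteq> j \<longrightarrow> card {t. cross T i j t} \<le> 1)"

end

theory Submission imports Defs begin

text \<open>
  Radix sort on the binary digits of the target position, most significant digit first:
  \<open>\<lceil>log\<^sub>2 n\<rceil>\<close> stages suffice.  In one stage, within each block of elements with the same
  leading digits, the elements with next digit 0 pass to the left of those with next digit 1.
  Letting the \<open>k\<close>-th 0 cross the \<open>j\<close>-th 1 at time \<open>k - j\<close> makes all crossings of a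
  given element consecutive, so that it moves at most once in the stage.  Two elements
  in their final relative order never leave it, hence no pair crosses twice.
\<close>

section \<open>Permutations given by the positions of their elements\<close>

text \<open>Here \<open>g\<close> sends elements to positions, while a permutation sends positions
  to entries; hence the \<open>inv\<close>. Integer values leave room for subtraction, and the
  identity outside \<open>{1..n}\<close> is what \<open>permutes\<close> demands.\<close>

definition perm_of :: "nat \<Rightarrow> (nat \<Rightarrow> int) \<Rightarrow> nat \<Rightarrow> nat" where
  "perm_of n g = inv (\<lambda>i. if i \<in> {1..n} then nat (g i) else i)"

lemma
  assumes "inj_on g {1..n}" and "\<And>i. i \<in> {1..n} \<Longrightarrow> g i \<in> {1..int n}"
  shows perm_of_permutes: "perm_of n g permutes {1..n}"
    and inv_perm_of: "i \<in> {1..n} \<Longrightarrow> int (inv (perm_of n g) i) = g i"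
proof -
  let ?f = "\<lambda>i. if i \<in> {1..n} then nat (g i) else i"
  have inj: "inj_on ?f {1..n}"
  proof (rule inj_onI)
    fix i j assume ij: "i \<in> {1..n}" "j \<in> {1..n}" "?f i = ?f j"
    then have "g i = g j"
      using assms(2)[OF ij(1)] assms(2)[OF ij(2)] by auto
    then show "i = j" using assms(1) ij by (auto dest: inj_onD)
  qed
  have "?f ` {1..n} \<subseteq> {1..n}" using assms(2) by fastforce
  then have "?f ` {1..n} = {1..n}"
    using endo_inj_surj[of "{1..n}" ?f] inj by blast
  then have f: "?f permutes {1..n}"
    using inj by (intro bij_imp_permutes) (auto simp: bij_betw_def)
  show "perm_of n g permutes {1..n}"
    unfolding perm_of_def by (rule permutes_inv[OF f])
  show "int (inv (perm_of n g) i) = g i" if "i \<in> {1..n}"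
  proof -
    have "inv (perm_of n g) i = ?f i"
      unfolding perm_of_def using inv_inv_eq[OF permutes_bij[OF f]] by simp
    then show ?thesis using that assms(2)[OF that] by simp
  qed
qed

lemma perm_of_cong: "(\<And>i. i \<in> {1..n} \<Longrightarrow> f i = g i) \<Longrightarrow> perm_of n f = perm_of n g"
  unfolding perm_of_def by (rule arg_cong[of _ _ inv]) auto

lemma perm_of_eq:
  assumes "p permutes {1..n}" and "\<And>i. i \<in> {1..n} \<Longrightarrow> g i = int (inv p i)"
  shows "perm_of n g = p"
proof -
  have "(\<lambda>i. if i \<in> {1..n} then nat (g i) else i) = inv p"
    using assms permutes_not_in[OF permutes_inv[OF assms(1)]] by fastforce
  then show ?thesis
    unfolding perm_of_def using inv_inv_eq[OF permutes_bij[OF assms(1)]] by simp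
qed

section \<open>Moves\<close>

text \<open>
  The repeated entry \<open>last xs = hd ys\<close> prevents any progression from straddling the junction.
\<close>

lemma moves_append_subset:
  assumes "xs \<noteq> []" "ys \<noteq> []" "last xs = hd ys"
  shows "moves (xs @ ys) \<subseteq> moves xs \<union> (\<lambda>(a, b). (a + length xs, b + length xs)) ` moves ys"
proof (rule subrelI)
  fix a b assume "(a, b) \<in> moves (xs @ ys)"
  then have up: "unit_progression (xs @ ys) a b"
    and mx: "\<And>a' b'. unit_progression (xs @ ys) a' b' \<Longrightarrow> a' \<le> a \<Longrightarrow> b \<le> b' \<Longrightarrow> a' = a \<and> b' = b"
    by (auto simp: moves_def)
  let ?l = "length xs"
  \<comment> \<open>Progressions of either part remain progressions of the concatenation; this
    passes maximality down to the parts.\<close>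
  have ext1: "unit_progression (xs @ ys) a' b'" if "unit_progression xs a' b'" for a' b'
    using that by (auto simp: unit_progression_def nth_append)
  have ext2: "unit_progression (xs @ ys) (a' + ?l) (b' + ?l)" if asm: "unit_progression ys a' b'" for a' b'
  proof -
    obtain d where d: "d \<in> {1,-1}" "\<forall>t\<in>{a'..<b'}. ys ! Suc t - ys ! t = d"
      using asm by (auto simp: unit_progression_def)
    have "\<forall>t\<in>{a'+?l..<b'+?l}. (xs @ ys) ! Suc t - (xs @ ys) ! t = d"
    proof
      fix t assume "t \<in> {a'+?l..<b'+?l}"
      then have "t - ?l \<in> {a'..<b'}" "?l \<le> t" by auto
      then show "(xs @ ys) ! Suc t - (xs @ ys) ! t = d"
        using d(2) by (auto simp: nth_append Suc_diff_le)
    qed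
    then show ?thesis using asm d(1) by (auto simp: unit_progression_def)
  qed
  obtain d where d: "d \<in> {1,-1}" "\<forall>t\<in>{a..<b}. (xs @ ys) ! Suc t - (xs @ ys) ! t = d"
    and ab: "a < b" "b < ?l + length ys"
    using up by (auto simp: unit_progression_def)
  consider "b < ?l" | "a < ?l" "?l \<le> b" | "?l \<le> a" by linarith
  then show "(a, b) \<in> moves xs \<union> (\<lambda>(a, b). (a + ?l, b + ?l)) ` moves ys"
  proof cases
    case 1
    have "unit_progression xs a b"
      using d 1 ab(1) by (auto simp: unit_progression_def nth_append)
    then have "(a, b) \<in> moves xs"
      using mx ext1 by (auto simp: moves_def)
    then show ?thesis by simp
  next
    case 2
    then have "?l - 1 \<in> {a..<b}" using assms(1) by auto
    moreover have "(xs @ ys) ! Suc (?l - 1) - (xs @ ys) ! (?l - 1) = 0"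
      using assms by (simp add: nth_append last_conv_nth hd_conv_nth)
    ultimately show ?thesis using d by fastforce
  next
    case 3
    have "unit_progression ys (a - ?l) (b - ?l)"
      unfolding unit_progression_def
    proof (intro conjI bexI[OF _ d(1)] ballI)
      fix t assume t: "t \<in> {a - ?l..<b - ?l}"
      then have "t + ?l \<in> {a..<b}" using 3 ab by auto
      then have "(xs @ ys) ! Suc (t + ?l) - (xs @ ys) ! (t + ?l) = d" using d(2) by blast
      then show "ys ! Suc t - ys ! t = d" by (simp add: nth_append)
    qed (use 3 ab in auto)
    moreover have "a' = a - ?l \<and> b' = b - ?l"
      if "unit_progression ys a' b'" "a' \<le> a - ?l" "b - ?l \<le> b'" for a' b'
    proof -
      have "a' + ?l \<le> a" "b \<le> b' + ?l" using that 3 ab by linarith+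
      then show ?thesis using mx[OF ext2[OF that(1)]] by force
    qed
    ultimately have "(a - ?l, b - ?l) \<in> moves ys"
      unfolding moves_def by blast
    then show ?thesis using 3 ab by (force simp: image_iff)
  qed
qed

lemma card_moves_append_le:
  assumes "xs \<noteq> []" "ys \<noteq> []" "last xs = hd ys"
  shows "card (moves (xs @ ys)) \<le> card (moves xs) + card (moves ys)"
proof -
  let ?h = "\<lambda>(a, b). (a + length xs, b + length xs)"
  have "card (moves (xs @ ys)) \<le> card (moves xs \<union> ?h ` moves ys)"
    by (intro card_mono moves_append_subset assms) (simp add: finite_moves)
  also have "\<dots> \<le> card (moves xs) + card (?h ` moves ys)" by (rule card_Un_le)
  also have "\<dots> \<le> card (moves xs) + card (moves ys)"
    using card_image_le[OF finite_moves] by simp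
  finally show ?thesis .
qed

text \<open>All nonzero differences have the same sign and fill one interval of indices, so the hull
  of two progressions is again a progression; two maximal ones therefore coincide. The bounds are
  integers because they may fall outside the list.\<close>

lemma card_moves_le_1:
  fixes lo hi :: int
  assumes d: "d \<in> {1, -1}"
    and diff: "\<And>t. Suc t < length xs \<Longrightarrow>
      xs ! Suc t - xs ! t = (if lo \<le> int t \<and> int t < hi then d else 0)"
  shows "card (moves xs) \<le> 1"
proof -
  have bounds: "lo \<le> int a \<and> int b \<le> hi" if up: "unit_progression xs a b" for a b
  proof -
    obtain e where e: "e \<in> {1, -1}" "\<forall>t\<in>{a..<b}. xs ! Suc t - xs ! t = e"
      and ab: "a < b" "b < length xs"
      using up by (auto simp: unit_progression_def)
    have "lo \<le> int t \<and> int t < hi" if "t \<in> {a..<b}" for t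
      using diff[of t] e that ab by (fastforce split: if_splits)
    moreover have "a \<in> {a..<b}" "b - 1 \<in> {a..<b}" using ab by auto
    ultimately have "lo \<le> int a" "int (b - 1) < hi" by blast+
    then show ?thesis using ab by (simp add: of_nat_diff)
  qed
  have up: "unit_progression xs a b"
    if "lo \<le> int a" "int b \<le> hi" "a < b" "b < length xs" for a b
    unfolding unit_progression_def
  proof (intro conjI bexI[OF _ d] ballI)
    fix t assume "t \<in> {a..<b}"
    then have "Suc t < length xs" "lo \<le> int t \<and> int t < hi" using that by auto
    then show "xs ! Suc t - xs ! t = d" using diff by simp
  qed (rule that)+
  have eq: "(a, b) = (a', b')" if m: "(a, b) \<in> moves xs" "(a', b') \<in> moves xs" for a b a' b'
  proof -
    have u: "unit_progression xs a b" "unit_progression xs a' b'"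
      using m by (auto simp: moves_def)
    then have "unit_progression xs (min a a') (max b b')"
      using bounds[OF u(1)] bounds[OF u(2)]
      by (intro up) (auto simp: unit_progression_def min_def max_def)
    moreover have "c = a \<and> e = b" if "unit_progression xs c e" "c \<le> a" "b \<le> e" for c e
      using m(1) that unfolding moves_def by blast
    moreover have "c = a' \<and> e = b'" if "unit_progression xs c e" "c \<le> a'" "b' \<le> e" for c e
      using m(2) that unfolding moves_def by blast
    ultimately show ?thesis by (metis max.cobounded1 max.cobounded2 min.cobounded1 min.cobounded2)
  qed
  show ?thesis
    using eq by (subst One_nat_def, subst card_le_Suc0_iff_eq) (auto simp: finite_moves)
qed

section \<open>Monotone steps\<close>

text \<open>The key \<open>f\<close> encodes the target order. With equal keys the condition applies
  in both directions, so such pairs are never exchanged.\<close>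

definition sorting_step :: "nat \<Rightarrow> (nat \<Rightarrow> nat) \<Rightarrow> (nat \<Rightarrow> nat) \<Rightarrow> (nat \<Rightarrow> nat) \<Rightarrow> bool" where
  "sorting_step n f p q \<longleftrightarrow> adjacent n p q \<and>
     (\<forall>i\<in>{1..n}. \<forall>j\<in>{1..n}. f i \<le> f j \<and> inv p i < inv p j \<longrightarrow> inv q i < inv q j)"

text \<open>Covers the junction of two stages, where one permutation is repeated.\<close>

lemma sorting_step_refl: "sorting_step n f p p"
  by (auto simp: sorting_step_def adjacent_def)

text \<open>For \<open>f i \<le> f j\<close>, a crossing can only bring \<open>i\<close> in front of
  \<open>j\<close>. By persistence \<open>i\<close> then stays in front, whereas a second crossing
  would have to start with \<open>j\<close> in front.\<close>

lemma simple_if_sorting_steps: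
  assumes "successively (sorting_step n f) T" and perm: "\<forall>p\<in>set T. p permutes {1..n}"
  shows "simple n T"
proof -
  have persist: "inv (T ! t') i < inv (T ! t') j"
    if ij: "i \<in> {1..n}" "j \<in> {1..n}" "f i \<le> f j"
      and t: "inv (T ! t) i < inv (T ! t) j" "t \<le> t'" "t' < length T" for i j t t'
    using t(2,3)
  proof (induction t' rule: dec_induct)
    case (step m)
    then show ?case
      using assms ij unfolding successively_conv_nth sorting_step_def by simp
  qed (rule t(1))
  have le: "card {t. cross T i j t} \<le> 1"
    if ij: "i \<in> {1..n}" "j \<in> {1..n}" "i \<noteq> j" "f i \<le> f j" for i j
  proof -
    have "\<not> t < t'" if c: "cross T i j t" "cross T i j t'" for t t'
    proof
      assume "t < t'"
      have less: "inv (T ! Suc s) i < inv (T ! Suc s) j" if s: "cross T i j s" for s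
      proof (rule ccontr)
        assume *: "\<not> ?thesis"
        have sw: "Suc s < length T" "inv (T ! Suc s) i = inv (T ! s) j"
          "inv (T ! Suc s) j = inv (T ! s) i"
          using s by (auto simp: cross_def)
        then have "\<not> inv (T ! s) i < inv (T ! s) j"
          using * persist[OF ij(1,2,4), of s "Suc s"] by (metis Suc_n_not_le_n nat_le_linear)
        then have "inv (T ! s) i = inv (T ! s) j" using * sw by linarith
        moreover have "T ! s permutes {1..n}"
          using perm sw(1) by simp
        ultimately show False
          using ij(3) permutes_inj[OF permutes_inv] by (metis injD)
      qed
      have "inv (T ! t') i < inv (T ! t') j"
        using persist[OF ij(1,2,4) less[OF c(1)], of t'] \<open>t < t'\<close> c(2) by (auto simp: cross_def)
      then show False using less[OF c(2)] c(2) by (auto simp: cross_def)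
    qed
    then have "\<forall>t\<in>{t. cross T i j t}. \<forall>t'\<in>{t. cross T i j t}. t = t'"
      by (metis mem_Collect_eq linorder_neqE_nat)
    then show ?thesis
      using card_le_Suc0_iff_eq[OF finite_crossings] by (metis One_nat_def)
  qed
  \<comment> \<open>Crossing is symmetric in the two paths, so assuming \<open>f i \<le> f j\<close>
    was no restriction.\<close>
  have "cross T i j = cross T j i" for i j
    by (auto simp: cross_def fun_eq_iff)
  then show ?thesis
    unfolding simple_def using le by (metis nat_le_linear)
qed

section \<open>One stage of the radix sort\<close>

lemma card_Un_three:
  assumes "finite A" "finite B" "finite C" "A \<inter> B = {}" "A \<inter> C = {}" "B \<inter> C = {}"
  shows "card A + card B + card C = card (A \<union> B \<union> C)"
  using assms by (simp add: card_Un_disjoint Int_Un_distrib2)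

lemma card_less_witness:
  assumes "finite B" "A \<subseteq> B" "x \<in> B" "x \<notin> A"
  shows "card A < card B"
  using assms by (metis psubset_card_mono psubsetI)

text \<open>The one-based position of \<open>i\<close> after stably sorting the identity by the key
  \<open>u\<close>; ties are broken by label.\<close>

definition rank :: "nat \<Rightarrow> (nat \<Rightarrow> nat) \<Rightarrow> nat \<Rightarrow> int" where
  "rank n u i = int (card {j \<in> {1..n}. u j < u i \<or> u j = u i \<and> j \<le> i})"

context
  fixes n :: nat and u :: "nat \<Rightarrow> nat"
begin

text \<open>The key \<open>u\<close> consists of the digits read so far including the current one:
  \<open>u j div 2\<close> names the block of \<open>j\<close>, and the parity of \<open>u j\<close>
  is its new digit. The positions of a block begin right after \<open>below\<close>.\<close>

definition below :: "nat \<Rightarrow> int" where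
  "below i = int (card {j \<in> {1..n}. u j div 2 < u i div 2})"

text \<open>Labels can stand in for positions: at the start of a stage each block is in increasing
  order of labels. The count includes \<open>i\<close>, so the first 0 of a block has index
  1.\<close>

definition evens :: "nat \<Rightarrow> int" where
  "evens i = int (card {j \<in> {1..n}. u j div 2 = u i div 2 \<and> even (u j) \<and> j \<le> i})"

definition odds :: "nat \<Rightarrow> int" where
  "odds i = int (card {j \<in> {1..n}. u j div 2 = u i div 2 \<and> odd (u j) \<and> j \<le> i})"

definition all_evens :: "nat \<Rightarrow> int" where
  "all_evens i = int (card {j \<in> {1..n}. u j div 2 = u i div 2 \<and> even (u j)})"

definition all_odds :: "nat \<Rightarrow> int" where
  "all_odds i = int (card {j \<in> {1..n}. u j div 2 = u i div 2 \<and> odd (u j)})"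

text \<open>
  A 0 starts at \<open>evens + odds\<close>, ends at \<open>evens\<close> and travels on the diagonal \<open>2 * evens - t\<close>;
  a 1 ends at \<open>all_evens + odds\<close> and travels on \<open>2 * odds + t - 1\<close>.  Diagonals of the two
  kinds have different parities, so they never meet.
\<close>

definition route :: "int \<Rightarrow> nat \<Rightarrow> int" where
  "route t i = below i +
     (if even (u i) then max (evens i) (min (evens i + odds i) (2 * evens i - t))
      else min (all_evens i + odds i) (max (evens i + odds i) (2 * odds i + t - 1)))"

lemmas count_defs = below_def evens_def odds_def all_evens_def all_odds_def

section \<open>Counting within and across blocks\<close>

lemma counts:
  shows "0 \<le> below i" "0 \<le> evens i" "0 \<le> odds i" "evens i \<le> all_evens i" "odds i \<le> all_odds i"
  by (auto simp: count_defs intro!: card_mono)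

lemma own_count:
  assumes "i \<in> {1..n}"
  shows "even (u i) \<Longrightarrow> 1 \<le> evens i" "odd (u i) \<Longrightarrow> 1 \<le> odds i"
  using assms by (auto simp: count_defs Suc_le_eq card_gt_0_iff)

lemma total_count: "below i + all_evens i + all_odds i \<le> int n"
proof -
  let ?A = "{j \<in> {1..n}. u j div 2 < u i div 2}"
  let ?B = "{j \<in> {1..n}. u j div 2 = u i div 2 \<and> even (u j)}"
  let ?C = "{j \<in> {1..n}. u j div 2 = u i div 2 \<and> odd (u j)}"
  have "card ?A + card ?B + card ?C = card (?A \<union> ?B \<union> ?C)"
    by (rule card_Un_three) auto
  also have "\<dots> \<le> card {1..n}" by (rule card_mono) auto
  finally show ?thesis by (simp add: count_defs)
qed

lemma counts_across:
  assumes "u i div 2 < u j div 2"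
  shows "below i + all_evens i + all_odds i \<le> below j"
proof -
  let ?A = "{j \<in> {1..n}. u j div 2 < u i div 2}"
  let ?B = "{j \<in> {1..n}. u j div 2 = u i div 2 \<and> even (u j)}"
  let ?C = "{j \<in> {1..n}. u j div 2 = u i div 2 \<and> odd (u j)}"
  have "card ?A + card ?B + card ?C = card (?A \<union> ?B \<union> ?C)"
    by (rule card_Un_three) auto
  also have "\<dots> \<le> card {k \<in> {1..n}. u k div 2 < u j div 2}"
    using assms by (intro card_mono) auto
  finally show ?thesis by (simp add: count_defs)
qed

lemma counts_within:
  assumes "u i div 2 = u j div 2"
  shows "below i = below j" "all_evens i = all_evens j"
    and "i \<le> j \<Longrightarrow> evens i \<le> evens j" "i \<le> j \<Longrightarrow> odds i \<le> odds j"
    and "i < j \<Longrightarrow> j \<in> {1..n} \<Longrightarrow> even (u j) \<Longrightarrow> evens i < evens j"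
    and "i < j \<Longrightarrow> j \<in> {1..n} \<Longrightarrow> odd (u j) \<Longrightarrow> odds i < odds j"
proof -
  show "below i = below j" "all_evens i = all_evens j"
    and "i \<le> j \<Longrightarrow> evens i \<le> evens j" "i \<le> j \<Longrightarrow> odds i \<le> odds j"
    using assms by (auto simp: count_defs intro!: card_mono)
  show "evens i < evens j" if "i < j" "j \<in> {1..n}" "even (u j)"
    unfolding count_defs of_nat_less_iff
    using that assms by (intro card_less_witness[where x = j]) auto
  show "odds i < odds j" if "i < j" "j \<in> {1..n}" "odd (u j)"
    unfolding count_defs of_nat_less_iff
    using that assms by (intro card_less_witness[where x = j]) auto
qed

section \<open>Relative order of two routes\<close>

text \<open>The clamps in \<open>route\<close> lie between 1 and the size of the block, so distinct
  blocks never interfere.\<close>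

lemma route_range:
  assumes "i \<in> {1..n}"
  shows "below i + 1 \<le> route t i" "route t i \<le> below i + all_evens i + all_odds i"
  using counts[of i] own_count[OF assms] by (auto simp: route_def)

lemma route_less_across:
  assumes "i \<in> {1..n}" "j \<in> {1..n}" "u i div 2 < u j div 2"
  shows "route t i < route t j"
  using route_range[OF assms(1), of t] route_range[OF assms(2), of t] counts_across[OF assms(3)]
  by linarith

text \<open>For equal digits, both clamps and the diagonal are strictly larger for \<open>j\<close>,
  and \<open>min\<close> and \<open>max\<close> preserve strict inequality.\<close>

lemma route_less_within:
  assumes "i \<in> {1..n}" "j \<in> {1..n}" "u i = u j" "i < j"
  shows "route t i < route t j"
proof -
  have b: "u i div 2 = u j div 2" using assms by simp
  show ?thesis
    using counts_within[OF b] assms by (auto simp: route_def)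
qed

text \<open>The 0 starts in front of the 1 and only moves left, while the 1 only moves
  right.\<close>

lemma route_less_sorted:
  assumes "i \<in> {1..n}" "j \<in> {1..n}" "u i div 2 = u j div 2" "even (u i)" "odd (u j)" "i < j"
  shows "route t i < route t j"
  using counts_within[OF assms(3)] counts[of i] counts[of j] assms by (auto simp: route_def)

text \<open>Let \<open>c = evens i - odds j\<close>. At times \<open>c\<close> and
  \<open>c + 1\<close> both elements are on their diagonals, exchanging the relative positions
  \<open>evens i + odds j\<close> and \<open>evens i + odds j - 1\<close>. Monotonicity of the two
  routes settles all other times.\<close>

lemma route_crossing:
  assumes "i \<in> {1..n}" "j \<in> {1..n}" "u i div 2 = u j div 2" "even (u i)" "odd (u j)" "j < i"
  shows "t \<le> evens i - odds j \<Longrightarrow> route t j < route t i"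
    and "evens i - odds j < t \<Longrightarrow> route t i < route t j"
  using counts_within[OF assms(3)] counts_within[OF assms(3)[symmetric]]
    counts[of i] counts[of j] own_count[OF assms(1)] own_count[OF assms(2)] assms by (auto simp: route_def)

text \<open>Source of both injectivity and monotonicity of the routes: the order of a pair changes
  at most once, and then to the sorted one. The second alternative arises only for
  \<open>u i = u j\<close>.\<close>

lemma route_order:
  assumes ij: "i \<in> {1..n}" "j \<in> {1..n}" "i \<noteq> j" "u i \<le> u j"
  obtains "\<And>t. route t i < route t j"
    | "\<And>t. route t j < route t i"
    | c where "\<And>t. t \<le> c \<Longrightarrow> route t j < route t i" "\<And>t. c < t \<Longrightarrow> route t i < route t j"
proof -
  have "u i div 2 \<le> u j div 2" using ij by (simp add: div_le_mono)
  then consider "u i div 2 < u j div 2" | "u i = u j" | "u i div 2 = u j div 2" "even (u i)" "odd (u j)"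
  proof -
    have "u i = u j \<or> even (u i) \<and> odd (u j)" if "u i div 2 = u j div 2"
      using that ij(4) by presburger
    then show ?thesis using \<open>u i div 2 \<le> u j div 2\<close> that by linarith
  qed
  then show thesis
  proof cases
    case 1
    then show thesis using that(1) route_less_across ij by blast
  next
    case 2
    then show thesis using that(1,2) route_less_within ij by (metis linorder_neqE_nat)
  next
    case 3
    show thesis
    proof (cases "i < j")
      case True
      then show thesis using that(1) route_less_sorted ij 3 by blast
    next
      case False
      then have "j < i" using ij by simp
      then show thesis using that(3) route_crossing[OF ij(1,2) 3] by blast
    qed
  qed
qed

lemma route_neq:
  assumes "i \<in> {1..n}" "j \<in> {1..n}" "i \<noteq> j" "u i \<le> u j"
  shows "route t i \<noteq> route t j"
  using assms
proof (cases rule: route_order)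
  case (3 c)
  then show ?thesis by (metis less_irrefl not_le)
qed (metis less_irrefl)+

lemma inj_route: "inj_on (route t) {1..n}"
  using route_neq by (metis inj_onI nat_le_linear)

lemma route_mono:
  assumes "i \<in> {1..n}" "j \<in> {1..n}" "u i \<le> u j" "route t i < route t j" "t \<le> t'"
  shows "route t' i < route t' j"
proof -
  have "i \<noteq> j" using assms by auto
  from assms(1,2) this assms(3) show ?thesis
  proof (cases rule: route_order)
    case 2
    then show ?thesis using assms(4) by (meson less_asym)
  next
    case (3 c)
    then have "c < t" using assms(4) by (meson less_asym not_le)
    then show ?thesis using 3 assms(5) by simp
  qed
qed

lemma route_in_range: "i \<in> {1..n} \<Longrightarrow> route t i \<in> {1..int n}"
  using route_range[of i t] counts[of i] total_count[of i] by auto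

text \<open>Time \<open>- int n\<close> precedes every move, since
  \<open>evens i - odds i \<ge> - int n\<close>; each element is still at its starting
  position.\<close>

lemma route_start:
  assumes "i \<in> {1..n}"
  shows "route (- int n) i = rank n (\<lambda>j. u j div 2) i"
proof -
  let ?A = "{j \<in> {1..n}. u j div 2 < u i div 2}"
  let ?B = "{j \<in> {1..n}. u j div 2 = u i div 2 \<and> even (u j) \<and> j \<le> i}"
  let ?C = "{j \<in> {1..n}. u j div 2 = u i div 2 \<and> odd (u j) \<and> j \<le> i}"
  have "card ?A + card ?B + card ?C = card (?A \<union> ?B \<union> ?C)"
    by (rule card_Un_three) auto
  also have "?A \<union> ?B \<union> ?C = {j \<in> {1..n}. u j div 2 < u i div 2 \<or> u j div 2 = u i div 2 \<and> j \<le> i}"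
    by auto
  finally have "below i + evens i + odds i = rank n (\<lambda>j. u j div 2) i"
    by (simp add: count_defs rank_def)
  then show ?thesis
    using counts[of i] total_count[of i] by (auto simp: route_def)
qed

text \<open>By time \<open>int n + 1\<close> every clamp at the target is reached, since
  \<open>evens i\<close> and \<open>all_evens i - odds i\<close> are at most
  \<open>int n\<close>.\<close>

lemma route_end:
  assumes "i \<in> {1..n}"
  shows "route (int n + 1) i = rank n u i"
proof -
  let ?A = "{j \<in> {1..n}. u j div 2 < u i div 2}"
  \<comment> \<open>If \<open>u i\<close> is even, \<open>?B\<close> counts the 0s up to
    \<open>i\<close> and \<open>?C\<close> is empty; if it is odd, \<open>?B\<close> counts all 0s
    of the block and \<open>?C\<close> the 1s up to \<open>i\<close>.\<close>
  let ?B = "{j \<in> {1..n}. u j div 2 = u i div 2 \<and> even (u j) \<and> (odd (u i) \<or> j \<le> i)}"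
  let ?C = "{j \<in> {1..n}. u j div 2 = u i div 2 \<and> odd (u i) \<and> odd (u j) \<and> j \<le> i}"
  have split: "u j < u i \<or> u j = u i \<and> j \<le> i \<longleftrightarrow> u j div 2 < u i div 2 \<or>
      u j div 2 = u i div 2 \<and> even (u j) \<and> (odd (u i) \<or> j \<le> i) \<or>
      u j div 2 = u i div 2 \<and> odd (u i) \<and> odd (u j) \<and> j \<le> i" for j
    by (cases "even (u i)"; cases "even (u j)"; auto elim!: evenE oddE; presburger)
  have "card ?A + card ?B + card ?C = card (?A \<union> ?B \<union> ?C)"
    by (rule card_Un_three) auto
  also have "?A \<union> ?B \<union> ?C = {j \<in> {1..n}. u j < u i \<or> u j = u i \<and> j \<le> i}"
    unfolding split by auto
  finally have "rank n u i = below i + (if even (u i) then evens i else all_evens i + odds i)"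
    by (auto simp: count_defs rank_def)
  then show ?thesis
    using counts[of i] total_count[of i] by (auto simp: route_def)
qed

section \<open>The stage as a list of permutations\<close>

definition stage :: "(nat \<Rightarrow> nat) list" where
  "stage = map (\<lambda>t. perm_of n (route (int t - int n))) [0..<2 * n + 2]"

lemma inv_perm_of_route:
  "i \<in> {1..n} \<Longrightarrow> int (inv (perm_of n (route t)) i) = route t i"
  by (rule inv_perm_of[OF inj_route route_in_range])

lemma stage_permutes: "p \<in> set stage \<Longrightarrow> p permutes {1..n}"
  using perm_of_permutes[OF inj_route route_in_range] by (auto simp: stage_def)

lemma stage_neq_Nil: "stage \<noteq> []" by (simp add: stage_def)

lemma hd_stage: "hd stage = perm_of n (rank n (\<lambda>j. u j div 2))"
  unfolding stage_def by (simp add: hd_map hd_conv_nth del: upt_Suc) (intro perm_of_cong route_start)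

lemma last_stage: "last stage = perm_of n (rank n u)"
proof -
  have "last stage = perm_of n (route (int n + 1))"
    by (simp add: stage_def last_map algebra_simps)
  then show ?thesis using perm_of_cong[OF route_end] by simp
qed

lemma route_step: "\<bar>route t i - route (t + 1) i\<bar> \<le> 1"
  by (auto simp: route_def)

text \<open>The hypothesis makes \<open>u\<close> a coarsening of the order of \<open>f\<close>, as
  leading digits are; so \<open>route_mono\<close> applies to every pair with
  \<open>f i \<le> f j\<close>.\<close>

lemma stage_sorting:
  assumes "\<And>i j. i \<in> {1..n} \<Longrightarrow> j \<in> {1..n} \<Longrightarrow> f i \<le> f j \<Longrightarrow> u i \<le> u j"
  shows "successively (sorting_step n f) stage"
proof -
  have "sorting_step n f (perm_of n (route t)) (perm_of n (route (t + 1)))" for t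
  proof -
    have "inv (perm_of n (route (t + 1))) i < inv (perm_of n (route (t + 1))) j"
      if ij: "i \<in> {1..n}" "j \<in> {1..n}" "f i \<le> f j"
        "inv (perm_of n (route t)) i < inv (perm_of n (route t)) j" for i j
    proof -
      have "route t i < route t j"
        using ij(4) inv_perm_of_route[OF ij(1), of t] inv_perm_of_route[OF ij(2), of t] by linarith
      then have "route (t + 1) i < route (t + 1) j"
        using route_mono[of i j t "t + 1"] assms ij by simp
      then show ?thesis
        using inv_perm_of_route[OF ij(1), of "t + 1"] inv_perm_of_route[OF ij(2), of "t + 1"] by linarith
    qed
    then show ?thesis
      using route_step by (auto simp: sorting_step_def adjacent_def inv_perm_of_route)
  qed
  from this[of "int t - int n" for t] show ?thesis
    unfolding successively_conv_nth stage_def by (simp add: algebra_simps del: upt_Suc)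
qed

lemma stage_moves:
  assumes i: "i \<in> {1..n}"
  shows "card (moves (path stage i)) \<le> 1"
proof -
  have nth: "path stage i ! t = route (int t - int n) i" if "t < 2 * n + 2" for t
    using that inv_perm_of_route[OF i] by (simp add: path_def stage_def del: upt_Suc)
  have len: "length (path stage i) = 2 * n + 2" by (simp add: path_def stage_def)
  show ?thesis
  proof (cases "even (u i)")
    case True
    show ?thesis
    \<comment> \<open>The diagonal \<open>2 * evens i - t\<close> leaves the start at time
      \<open>evens i - odds i\<close> and reaches \<open>evens i\<close> at time
      \<open>evens i\<close>; list index is time plus \<open>n\<close>.\<close>
    proof (rule card_moves_le_1[of "-1" _ "int n + evens i - odds i" "int n + evens i"])
      fix t assume "Suc t < length (path stage i)"
      then show "path stage i ! Suc t - path stage i ! t =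
          (if int n + evens i - odds i \<le> int t \<and> int t < int n + evens i then - 1 else 0)"
        using counts[of i] True by (auto simp: len nth route_def)
    qed simp
  next
    case False
    show ?thesis
    \<comment> \<open>The additional 1 compensates the \<open>- 1\<close> in the diagonal
      \<open>2 * odds i + t - 1\<close>.\<close>
    proof (rule card_moves_le_1[of 1 _ "int n + 1 + evens i - odds i" "int n + 1 + all_evens i - odds i"])
      fix t assume "Suc t < length (path stage i)"
      then show "path stage i ! Suc t - path stage i ! t =
          (if int n + 1 + evens i - odds i \<le> int t \<and> int t < int n + 1 + all_evens i - odds i then 1 else 0)"
        using counts[of i] False by (auto simp: len nth route_def)
    qed simp
  qed
qed

end

section \<open>Concatenating the stages\<close>

lemma rank_const:
  assumes "i \<in> {1..n}" "\<And>j. j \<in> {1..n} \<Longrightarrow> u j = c"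
  shows "rank n u i = int i"
proof -
  have "{j \<in> {1..n}. u j < u i \<or> u j = u i \<and> j \<le> i} = {1..i}"
    using assms(1) by (auto simp: assms(2))
  then show ?thesis by (simp add: rank_def)
qed

text \<open>The keys are distinct on \<open>{1..n}\<close>, so only \<open>i\<close> itself ties,
  and \<open>s\<close> maps the counted set bijectively onto \<open>{1..s i}\<close>. Truncated
  subtraction is harmless because \<open>s j \<ge> 1\<close> there.\<close>

lemma rank_permutes:
  assumes "s permutes {1..n}" "i \<in> {1..n}"
  shows "rank n (\<lambda>j. s j - 1) i = int (s i)"
proof -
  have s: "s j \<in> {1..n} \<longleftrightarrow> j \<in> {1..n}" for j by (rule permutes_in_image[OF assms(1)])
  have inj: "inj s" using permutes_inj[OF assms(1)] .
  have "s ` {j \<in> {1..n}. s j - 1 < s i - 1 \<or> s j - 1 = s i - 1 \<and> j \<le> i} = {1..s i}"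
  proof (intro equalityI subsetI)
    fix x assume "x \<in> s ` {j \<in> {1..n}. s j - 1 < s i - 1 \<or> s j - 1 = s i - 1 \<and> j \<le> i}"
    then show "x \<in> {1..s i}" using s[of i] s assms(2) by fastforce
  next
    fix x assume x: "x \<in> {1..s i}"
    obtain j where j: "x = s j" using permutes_surj[OF assms(1)] by (elim surjE)
    have "s j \<in> {1..n}" using x j s[of i] assms(2) by auto
    then have "j \<in> {1..n}" using s by blast
    moreover have "s j - 1 < s i - 1 \<or> j = i"
    proof (cases "s j = s i")
      case True
      then show ?thesis using injD[OF inj] by blast
    next
      case False
      then show ?thesis using x j by auto
    qed
    ultimately show "x \<in> s ` {j \<in> {1..n}. s j - 1 < s i - 1 \<or> s j - 1 = s i - 1 \<and> j \<le> i}"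
      using j by auto
  qed
  then have "card {j \<in> {1..n}. s j - 1 < s i - 1 \<or> s j - 1 = s i - 1 \<and> j \<le> i} = s i"
    using card_image[OF inj_on_subset[OF inj subset_UNIV],
        of "{j \<in> {1..n}. s j - 1 < s i - 1 \<or> s j - 1 = s i - 1 \<and> j \<le> i}"] by simp
  then show ?thesis by (simp add: rank_def)
qed

text \<open>Induction on the number \<open>m\<close> of digits read: the list ends in the stable
  sort by the leading \<open>m\<close> of \<open>K\<close> digits, and each stage costs a path at
  most one move.\<close>

lemma sorting_list_exists:
  assumes "\<And>i. i \<in> {1..n} \<Longrightarrow> f i < 2 ^ K" and "m \<le> K"
  shows "\<exists>T. T \<noteq> [] \<and> (\<forall>p\<in>set T. p permutes {1..n}) \<and> successively (sorting_step n f) T \<and>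
    hd T = id \<and> last T = perm_of n (rank n (\<lambda>i. f i div 2 ^ (K - m))) \<and>
    (\<forall>i\<in>{1..n}. card (moves (path T i)) \<le> m)"
  using assms(2)
proof (induction m)
  case 0
  \<comment> \<open>Before any digit is read all keys are 0, so the stable sort is the
    identity.\<close>
  have "perm_of n (rank n (\<lambda>i. f i div 2 ^ K)) = id"
    using assms(1) by (intro perm_of_eq permutes_id) (simp only: rank_const[of _ n _ 0] div_less inv_id id_apply)
  moreover have "moves [x] = {}" for x by (auto simp: moves_def unit_progression_def)
  ultimately show ?case by (intro exI[of _ "[id]"]) (simp add: permutes_id[unfolded id_def] id_def path_def)
next
  case (Suc m)
  then obtain T where T: "T \<noteq> []" "\<forall>p\<in>set T. p permutes {1..n}" "successively (sorting_step n f) T"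
    "hd T = id" "last T = perm_of n (rank n (\<lambda>i. f i div 2 ^ (K - m)))"
    "\<forall>i\<in>{1..n}. card (moves (path T i)) \<le> m" using Suc_leD by blast
  \<comment> \<open>One more digit than before: halving \<open>u\<close> gives back the key by which
    \<open>T\<close> is already sorted, so the stage begins where \<open>T\<close> ends.\<close>
  define u where "u = (\<lambda>i. f i div 2 ^ (K - Suc m))"
  have "K - m = Suc (K - Suc m)" using Suc.prems by simp
  then have u: "(\<lambda>i. u i div 2) = (\<lambda>i. f i div 2 ^ (K - m))"
    by (simp add: u_def div_mult2_eq[symmetric] mult.commute)
  let ?S = "stage n u"
  have eq: "last T = hd ?S" using T(5) by (simp add: hd_stage u)
  have "successively (sorting_step n f) ?S"
    by (rule stage_sorting) (simp add: u_def div_le_mono)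
  then have "successively (sorting_step n f) (T @ ?S)"
    using T(3) by (simp add: successively_append_iff eq sorting_step_refl)
  moreover have "card (moves (path (T @ ?S) i)) \<le> Suc m" if i: "i \<in> {1..n}" for i
  proof -
    have "card (moves (path T i @ path ?S i)) \<le> card (moves (path T i)) + card (moves (path ?S i))"
      using T(1) stage_neq_Nil[of n u] eq
      by (intro card_moves_append_le) (auto simp: path_def last_map hd_map)
    then show ?thesis
      using T(6) i stage_moves[OF i, of u] by (fastforce simp: path_def)
  qed
  ultimately show ?case
    using T stage_neq_Nil[of n u] stage_permutes[of _ n u] last_stage[of n u]
    by (intro exI[of _ "T @ ?S"]) (auto simp: u_def)
qed

theorem proposition4:
  fixes n :: nat and \<pi> :: "nat \<Rightarrow> nat"
  assumes "n \<ge> 1" and "\<pi> permutes {1..n}"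
  shows "\<exists>T. tangle n T \<and> simple n T \<and> performs T \<pi> \<and>
           (\<forall>i\<in>{1..n}. int (card (moves (path T i))) \<le> \<lceil>log 2 (real n)\<rceil>)"
proof -
  define K where "K = nat \<lceil>log 2 (real n)\<rceil>"
  \<comment> \<open>Target positions are shifted to start at 0, so that \<open>n \<le> 2 ^ K\<close>
    lets them fit into \<open>K\<close> binary digits.\<close>
  define f where "f = (\<lambda>i. inv \<pi> i - 1)"
  have "0 \<le> log 2 (real n)" using assms(1) by simp
  then have K: "int K = \<lceil>log 2 (real n)\<rceil>" by (simp add: K_def)
  have "log 2 (real n) \<le> real K" using K by linarith
  then have "real n \<le> 2 ^ K" using assms(1) by (simp add: log_le_iff powr_realpow)
  then have n: "n \<le> 2 ^ K" by (metis of_nat_le_iff of_nat_numeral of_nat_power)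
  have inv: "inv \<pi> permutes {1..n}" by (rule permutes_inv[OF assms(2)])
  have "f i < 2 ^ K" if "i \<in> {1..n}" for i
    using permutes_in_image[OF inv, of i] that n by (auto simp: f_def)
  \<comment> \<open>With all \<open>K\<close> digits read, the divisor is \<open>2 ^ 0\<close> and
    the final key is \<open>f\<close> itself.\<close>
  from sorting_list_exists[of n f K K, OF this]
  obtain T where T: "T \<noteq> []" "\<forall>p\<in>set T. p permutes {1..n}" "successively (sorting_step n f) T"
    "hd T = id" "last T = perm_of n (rank n f)" "\<forall>i\<in>{1..n}. card (moves (path T i)) \<le> K" by auto
  have "last T = \<pi>"
    unfolding T(5) using rank_permutes[OF inv] by (intro perm_of_eq assms) (simp add: f_def)
  moreover have "tangle n T"
    using T by (auto simp: tangle_def successively_conv_nth sorting_step_def)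
  moreover have "int (card (moves (path T i))) \<le> \<lceil>log 2 (real n)\<rceil>" if "i \<in> {1..n}" for i
    using T(6) that K by fastforce
  ultimately show ?thesis
    using T(1,4) simple_if_sorting_steps[OF T(3,2)] by (auto simp: performs_def)
qed

end
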